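(* Let $n\ge 1$. A matrix $A\in M_n(\mathbb{T})$ over the extended tropical semiring is E-dense in $M_n(\mathbb{T})$ with respect to $U_n^{\mathrm{idm}}(\mathbb{T})$ (i.e. there exists $B\in M_n(\mathbb{T})$ with $AB\in U_n^{\mathrm{idm}}(\mathbb{T})$ and $BA\in U_n^{\mathrm{idm}}(\mathbb{T})$) if and only if $A$ is tropically regular.
   Context: Extended tropical semiring. Let $\mathbb{R}^\nu=\{a^\nu : a\in\mathbb{R}\}$ be a disjoint copy of $\mathbb{R}$, let $-\infty$ be a formal element, and put $\mathbb{T}=\mathbb{R}\cup\{-\infty\}\cup\mathbb{R}^\nu$ (disjoint union), $\bar{\mathbb{R}}^\nu=\mathbb{R}^\nu\cup\{-\infty\}$. Order $\prec$ on $\mathbb{T}$: $-\infty\prec x$ for all $x\ne-\infty$; for real $a<b$: $a\prec b$, $a\prec b^\nu$, $a^\nu\prec b$, $a^\nu\prec b^\nu$; and $a\prec a^\nu$ for all $a\in\mathbb{R}$. Addition $\oplus$: $-\infty\oplus x=x\oplus-\infty=x$; $x\oplus y=\max_\prec\{x,y\}$ if $x\neq y$; $a\oplus a=a^\nu\oplus a^\nu=a^\nu$ for $a\in\mathbb{R}$. Multiplication $\odot$ (written as juxtaposition): $-\infty\odot x=x\odot-\infty=-\infty$; $a\odot b=a+b$ for $a,b\in\mathbb{R}$; $a^\nu\odot b=a\odot b^\nu=a^\nu\odot b^\nu=(a+b)^\nu$. This is a commutative semiring with zero $-\infty$ and unit the real number $0$. $M_n(\mathbb{T})$ is the semiring of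 $n\times n$ matrices over $\mathbb{T}$ with the usual matrix operations induced from $\oplus,\odot$. The tropical determinant of $A=(a_{ij})$ is $|A|=\bigoplus_{\sigma\in S_n} a_{1\sigma(1)}\odot\cdots\odot a_{n\sigma(n)}$. $A$ is tropically singular if $|A|\in\bar{\mathbb{R}}^\nu$, and tropically regular otherwise (i.e. if $|A|\in\mathbb{R}$). A pseudo unit matrix is a tropically regular matrix in $M_n(\mathbb{T})$ all of whose diagonal entries equal the real number $0$ and all of whose off-diagonal entries lie in $\bar{\mathbb{R}}^\nu$. $U_n^{\mathrm{idm}}(\mathbb{T})$ is the set of all pseudo unit matrices $I$ that are idempotent, $I^2=I$. *)

theory Defs
  imports "HOL-Analysis.Determinants"
begin

text \<open>The extended tropical semiring: \<open>Tan a\<close> is the real number \<open>a\<close>, \<open>Gho a\<close> is its ghost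
  copy \<open>a\<^sup>\<nu>\<close>, and \<open>NegInf\<close> is \<open>-\<infinity>\<close>.\<close>

datatype xtrop = NegInf | Tan real | Gho real

instantiation xtrop :: linorder
begin

fun less_xtrop :: "xtrop \<Rightarrow> xtrop \<Rightarrow> bool" where
  "x < NegInf \<longleftrightarrow> False"
| "NegInf < Tan b \<longleftrightarrow> True"
| "NegInf < Gho b \<longleftrightarrow> True"
| "Tan a < Tan b \<longleftrightarrow> a < b"
| "Tan a < Gho b \<longleftrightarrow> a \<le> b"
| "Gho a < Tan b \<longleftrightarrow> a < b"
| "Gho a < Gho b \<longleftrightarrow> a < b"

definition less_eq_xtrop :: "xtrop \<Rightarrow> xtrop \<Rightarrow> bool" where
  "x \<le> y \<longleftrightarrow> x < y \<or> x = (y :: xtrop)"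

instance
proof
  fix x y z :: xtrop
  show "(x < y) = (x \<le> y \<and> \<not> y \<le> x)"
    by (cases x; cases y) (auto simp: less_eq_xtrop_def)
  show "x \<le> x"
    by (simp add: less_eq_xtrop_def)
  show "x \<le> y \<Longrightarrow> y \<le> z \<Longrightarrow> x \<le> z"
    by (cases x; cases y; cases z) (auto simp: less_eq_xtrop_def)
  show "x \<le> y \<Longrightarrow> y \<le> x \<Longrightarrow> x = y"
    by (cases x; cases y) (auto simp: less_eq_xtrop_def)
  show "x \<le> y \<or> y \<le> x"
    by (cases x; cases y) (auto simp: less_eq_xtrop_def)
qed

end

fun ghost :: "xtrop \<Rightarrow> xtrop" where
  "ghost NegInf = NegInf"
| "ghost (Tan a) = Gho a"
| "ghost (Gho a) = Gho a"

text \<open>The operations \<open>\<oplus>\<close> and \<open>\<odot>\<close> become the type-class operations \<open>+\<close> and \<open>*\<close>. Hence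
  \<open>0 :: xtrop\<close> denotes \<open>-\<infinity>\<close>, whereas \<open>1 :: xtrop\<close> denotes the real number \<open>0\<close>.\<close>

instantiation xtrop :: comm_semiring_1
begin

definition zero_xtrop :: xtrop where "0 = NegInf"

definition one_xtrop :: xtrop where "1 = Tan 0"

definition plus_xtrop :: "xtrop \<Rightarrow> xtrop \<Rightarrow> xtrop" where
  "x + y = (if x = y then ghost x else max x y)"

fun times_xtrop :: "xtrop \<Rightarrow> xtrop \<Rightarrow> xtrop" where
  "NegInf * y = NegInf"
| "x * NegInf = NegInf"
| "Tan a * Tan b = Tan (a + b)"
| "Tan a * Gho b = Gho (a + b)"
| "Gho a * Tan b = Gho (a + b)"
| "Gho a * Gho b = Gho (a + b)"

instance
proof
  fix a b c :: xtrop
  show "a + b + c = a + (b + c)"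
    by (cases a; cases b; cases c) (auto simp: plus_xtrop_def max_def less_eq_xtrop_def)
  show "a + b = b + a"
    by (auto simp: plus_xtrop_def max.commute)
  show "0 + a = a"
    by (cases a) (auto simp: plus_xtrop_def zero_xtrop_def max_def less_eq_xtrop_def)
  show "a * b * c = a * (b * c)"
    by (cases a; cases b; cases c) auto
  show "a * b = b * a"
    by (cases a; cases b) auto
  show "1 * a = a"
    by (cases a) (auto simp: one_xtrop_def)
  show "(a + b) * c = a * c + b * c"
    by (cases a; cases b; cases c) (auto simp: plus_xtrop_def max_def less_eq_xtrop_def)
  show "0 * a = 0"
    by (simp add: zero_xtrop_def)
  show "a * 0 = 0"
    by (cases a) (simp_all add: zero_xtrop_def)
  show "(0 :: xtrop) \<noteq> 1"
    by (simp add: zero_xtrop_def one_xtrop_def)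
qed

end

definition ghosts_bar :: "xtrop set" where
  "ghosts_bar = insert NegInf (range Gho)"

definition trop_det :: "xtrop ^ 'n ^ 'n \<Rightarrow> xtrop" where
  "trop_det A = (\<Sum>\<sigma> | \<sigma> permutes (UNIV :: 'n set). \<Prod>i\<in>UNIV. A $ i $ \<sigma> i)"

definition trop_singular :: "xtrop ^ 'n ^ 'n \<Rightarrow> bool" where
  "trop_singular A \<longleftrightarrow> trop_det A \<in> ghosts_bar"

definition trop_regular :: "xtrop ^ 'n ^ 'n \<Rightarrow> bool" where
  "trop_regular A \<longleftrightarrow> \<not> trop_singular A"

definition pseudo_unit :: "xtrop ^ 'n ^ 'n \<Rightarrow> bool" where
  "pseudo_unit I \<longleftrightarrow> trop_regular I \<and> (\<forall>i. I $ i $ i = Tan 0) \<and>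
     (\<forall>i j. i \<noteq> j \<longrightarrow> I $ i $ j \<in> ghosts_bar)"

definition U_idm :: "(xtrop ^ 'n ^ 'n) set" where
  "U_idm = {I. pseudo_unit I \<and> I ** I = I}"

definition E_dense_wrt :: "(xtrop ^ 'n ^ 'n) set \<Rightarrow> xtrop ^ 'n ^ 'n \<Rightarrow> bool" where
  "E_dense_wrt E A \<longleftrightarrow> (\<exists>B. A ** B \<in> E \<and> B ** A \<in> E)"

end

theory Submission imports Defs "HOL-Combinatorics.Cycles" begin

text \<open>Regularity of \<open>A\<close> says that exactly one permutation attains the maximum in the
  tropical determinant and that all the entries it picks are tangible (of the form \<open>Tan a\<close>).

  If \<open>A ** B\<close> is regular, then so is \<open>A\<close>. Expanding \<open>|A ** B|\<close> over all pairs of a permutation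
  \<open>\<sigma>\<close> and an arbitrary index function \<open>f\<close> (the inner summation indices), exactly one pair
  is maximal. Its \<open>f\<close> is injective, since for \<open>f p = f q\<close> the pair \<open>(\<sigma> \<circ> (p q), f)\<close> has the same
  weight; and no other permutation can do as well in \<open>|A|\<close> as \<open>f\<close>, since replacing \<open>f\<close> by it and adapting \<open>\<sigma>\<close>
  would yield a second maximal pair. This is \<open>trop_regular_mult_left\<close>.

  Conversely, let \<open>\<sigma>\<close> be the optimal permutation of a regular \<open>A\<close>. Dividing the rows by the tangible
  entries at \<open>(i, \<sigma> i)\<close> and permuting them turns \<open>A\<close> into a matrix \<open>N\<close> with unit
  diagonal in which every permutation other than the identity has negative weight. Linear
  programming duality for the assignment problem, here with strict slack
  (\<open>ex_strict_potential\<close>), provides real potentials \<open>u\<close> and \<open>\<epsilon> > 0\<close> such that the off-diagonal entries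
  satisfy \<open>N i j \<le> (u i - u j - \<epsilon>)\<^sup>\<nu>\<close>. Let \<open>U\<close> have unit diagonal and exactly these
  ghosts off the diagonal. The slack makes \<open>U\<close> regular and the detour \<open>i, k, j\<close> never better
  than the step \<open>i, j\<close>, and a ghost absorbs everything below it; so
  \<open>U ** U = N ** U = U ** N = U\<close>. Undoing the normalisation on \<open>U\<close> gives the matrix \<open>B\<close>: then
  \<open>B ** A = U\<close>, and \<open>A ** B\<close> is a conjugate of \<open>U\<close>, which is again of the form
  of \<open>U\<close> for the potentials \<open>i \<mapsto> A i (\<sigma> i) + u (\<sigma> i)\<close>.

  The matrix \<open>U\<close> dominates the off-diagonal part of the normalised tropical adjoint instead of
  being equal to it, which avoids any computation with cofactors.\<close>

section \<open>Order and arithmetic of the extended tropical semiring\<close>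

instance xtrop :: ordered_comm_semiring
proof
  fix a b c :: xtrop
  show "a \<le> b \<Longrightarrow> c + a \<le> c + b"
    by (cases a; cases b; cases c)
      (auto simp: plus_xtrop_def max_def less_eq_xtrop_def split: if_splits)
  show "a \<le> b \<Longrightarrow> 0 \<le> c \<Longrightarrow> c * a \<le> c * b"
    by (cases a; cases b; cases c) (auto simp: less_eq_xtrop_def)
qed

lemma zero_le_xtrop [simp]: "0 \<le> (x :: xtrop)"
  by (cases x) (auto simp: less_eq_xtrop_def zero_xtrop_def)

lemma xtrop_le_simps [simp]:
  "NegInf \<le> x" "x \<le> NegInf \<longleftrightarrow> x = NegInf"
  "Tan a \<le> Tan b \<longleftrightarrow> a \<le> b" "Tan a \<le> Gho b \<longleftrightarrow> a \<le> b"
  "Gho a \<le> Tan b \<longleftrightarrow> a < b" "Gho a \<le> Gho b \<longleftrightarrow> a \<le> b"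
  by (cases x; auto simp: less_eq_xtrop_def)+

lemma xtrop_mult_mono: "a \<le> b \<Longrightarrow> c \<le> d \<Longrightarrow> a * c \<le> b * (d :: xtrop)"
  by (rule mult_mono) auto

lemma xtrop_prod_mono:
  fixes f g :: "'a \<Rightarrow> xtrop"
  assumes "\<And>i. i \<in> S \<Longrightarrow> f i \<le> g i"
  shows "prod f S \<le> prod g S"
  using assms by (induction S rule: infinite_finite_induct) (auto intro: xtrop_mult_mono)

lemma one_xtrop_eq: "Tan 0 = 1" by (simp add: one_xtrop_def)

lemma mult_less_one:
  assumes "x < 1" "y \<le> 1" shows "x * y < (1::xtrop)"
  using assms by (cases x; cases y) (auto simp: one_xtrop_def)

lemma prod_less_one:
  fixes f :: "'a \<Rightarrow> xtrop"
  assumes "finite S" "j \<in> S" "f j < 1" "\<And>i. i \<in> S \<Longrightarrow> f i \<le> 1"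
  shows "prod f S < 1"
proof -
  have "prod f (S - {j}) \<le> prod (\<lambda>_. 1) (S - {j})"
    using assms by (intro xtrop_prod_mono) auto
  then show ?thesis
    using mult_less_one assms by (simp add: prod.remove)
qed

lemma Tan_mult_cancel_less [simp]: "Tan a * x < Tan (a + b) \<longleftrightarrow> x < Tan b"
  by (cases x) auto

lemma prod_Tan: "(\<Prod>i\<in>S. Tan (g i)) = Tan (\<Sum>i\<in>S. g i)"
  by (induction S rule: infinite_finite_induct) (auto simp: one_xtrop_def)

lemma mult_eq_Tan_iff: "x * y = Tan t \<longleftrightarrow> (\<exists>a b. x = Tan a \<and> y = Tan b \<and> t = a + b)"
  by (cases x; cases y) auto

lemma prod_eq_TanD:
  assumes "prod f S = Tan t" "finite S" "i \<in> S" shows "\<exists>a. f i = Tan a"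
  using assms by (auto simp: prod.remove[of S i] mult_eq_Tan_iff)

lemma add_less_Tan_iff: "x + y < Tan t \<longleftrightarrow> x < Tan t \<and> y < Tan t"
  by (cases x; cases y) (auto simp: plus_xtrop_def max_def)

lemma add_eq_Tan_iff: "x + y = Tan t \<longleftrightarrow> x = Tan t \<and> y < Tan t \<or> y = Tan t \<and> x < Tan t"
  by (cases x; cases y) (auto simp: plus_xtrop_def max_def)

lemma sum_less_Tan_iff:
  assumes "finite S" shows "sum f S < Tan t \<longleftrightarrow> (\<forall>i\<in>S. f i < Tan t)"
  using assms by (induction S rule: finite_induct) (auto simp: add_less_Tan_iff zero_xtrop_def)

text \<open>A maximum that is attained twice turns into a ghost, so a tangible sum has a unique
  dominating summand.\<close>

lemma sum_eq_Tan_iff: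
  assumes "finite S"
  shows "sum f S = Tan t \<longleftrightarrow> (\<exists>i\<in>S. f i = Tan t \<and> (\<forall>j\<in>S - {i}. f j < Tan t))"
  using assms
proof (induction S rule: finite_induct)
  case (insert x S)
  then show ?case
    by (auto simp: add_eq_Tan_iff sum_less_Tan_iff)
qed (simp add: zero_xtrop_def)

lemma ghosts_bar_iff: "x \<in> ghosts_bar \<longleftrightarrow> (\<forall>t. x \<noteq> Tan t)"
  by (cases x) (auto simp: ghosts_bar_def)

text \<open>A ghost absorbs everything below it, including its tangible copy, and further copies of
  itself.\<close>

lemma sum_eq_ghost:
  assumes "finite S" "j \<in> S" "f j \<in> ghosts_bar" "\<And>i. i \<in> S \<Longrightarrow> f i \<le> f j"
  shows "sum f S = f j"
proof -
  have "sum f T + f j = f j" if "T \<subseteq> S" for T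
    using finite_subset[OF that assms(1)] that
  proof (induction T rule: finite_induct)
    case (insert x T)
    have "x' + f j = f j" if "x' \<le> f j" for x'
      using that assms(3) by (cases x'; cases "f j") (auto simp: plus_xtrop_def ghosts_bar_def)
    with insert assms(4)[of x] show ?case
      by (simp add: add.assoc)
  qed simp
  from this[of "S - {j}"] show ?thesis
    using assms by (simp add: sum.remove add.commute)
qed

section \<open>Regularity and products\<close>

lemma trop_regular_iff_det: "trop_regular A \<longleftrightarrow> (\<exists>t. trop_det A = Tan t)"
  by (simp add: trop_regular_def trop_singular_def ghosts_bar_iff)

lemma trop_regular_iff:
  "trop_regular A \<longleftrightarrow> (\<exists>\<sigma> t. \<sigma> permutes UNIV \<and> (\<Prod>i\<in>UNIV. A $ i $ \<sigma> i) = Tan t \<and>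
     (\<forall>\<tau>. \<tau> permutes UNIV \<longrightarrow> \<tau> \<noteq> \<sigma> \<longrightarrow> (\<Prod>i\<in>UNIV. A $ i $ \<tau> i) < Tan t))"
  unfolding trop_regular_iff_det trop_det_def
  by (subst sum_eq_Tan_iff) (auto simp: finite_permutations)

lemma trop_det_mult:
  fixes A B :: "xtrop ^ 'n ^ 'n"
  shows "trop_det (A ** B) = (\<Sum>(\<sigma>, f) \<in> {\<sigma>. \<sigma> permutes UNIV} \<times> UNIV.
           (\<Prod>i\<in>UNIV. A $ i $ f i) * (\<Prod>i\<in>UNIV. B $ f i $ \<sigma> i))"
proof -
  have "(\<Prod>i\<in>UNIV. (A ** B) $ i $ \<sigma> i) =
      (\<Sum>f\<in>UNIV. (\<Prod>i\<in>UNIV. A $ i $ f i) * (\<Prod>i\<in>UNIV. B $ f i $ \<sigma> i))" for \<sigma> :: "'n \<Rightarrow> 'n"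
    by (simp add: matrix_matrix_mult_def prod_sum_PiE PiE_UNIV_domain prod.distrib)
  then show ?thesis
    by (simp add: trop_det_def sum.cartesian_product)
qed

text \<open>Reindexing the factors that come from \<open>B\<close> turns a repeated value of the optimal index function \<open>f\<close>,
  as well as a permutation that is at least as good for \<open>A\<close> as \<open>f\<close>, into a second maximal
  term of \<open>|A ** B|\<close>.\<close>

lemma trop_regular_mult_left:
  fixes A B :: "xtrop ^ 'n ^ 'n"
  assumes "trop_regular (A ** B)" shows "trop_regular A"
proof -
  define F where "F = (\<lambda>\<sigma> f. (\<Prod>i\<in>UNIV. A $ i $ f i) * (\<Prod>i\<in>UNIV. B $ f i $ \<sigma> i))"
  obtain t where "trop_det (A ** B) = Tan t"
    using assms by (auto simp: trop_regular_iff_det)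
  then have "(\<Sum>(\<sigma>, f) \<in> {\<sigma>. \<sigma> permutes UNIV} \<times> UNIV. F \<sigma> f) = Tan t"
    by (simp add: trop_det_mult F_def)
  then obtain p where p: "p \<in> {\<sigma>. \<sigma> permutes UNIV} \<times> UNIV" "case_prod F p = Tan t"
    "\<forall>q\<in>{\<sigma>. \<sigma> permutes UNIV} \<times> UNIV - {p}. case_prod F q < Tan t"
    by (subst (asm) sum_eq_Tan_iff) (auto simp: finite_permutations)
  obtain \<sigma> f where p_eq: "p = (\<sigma>, f)"
    by (cases p)
  have \<sigma>: "\<sigma> permutes UNIV" and max: "F \<sigma> f = Tan t"
    using p by (auto simp: p_eq)
  have less: "F \<tau> g < Tan t" if "\<tau> permutes UNIV" "(\<tau>, g) \<noteq> (\<sigma>, f)" for \<tau> g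
    using bspec[OF p(3), of "(\<tau>, g)"] that by (auto simp: p_eq)
  have "inj f"
  proof (rule ccontr)
    assume "\<not> inj f"
    then obtain p q where pq: "f p = f q" "p \<noteq> q"
      by (auto simp: inj_def)
    \<comment> \<open>Swapping two indices with the same \<open>f\<close>-value only reorders the factors from \<open>B\<close>.\<close>
    define s where "s = Transposition.transpose p q"
    have s: "s permutes UNIV" and fs: "f (s i) = f i" for i
      using pq by (auto simp: s_def permutes_swap_id Transposition.transpose_def)
    have "F (\<sigma> \<circ> s) f = F \<sigma> f"
      unfolding F_def
      using prod.permute[OF s, of "\<lambda>i. B $ f i $ \<sigma> i"] by (simp add: fs o_def)
    moreover have "\<sigma> \<circ> s \<noteq> \<sigma>"
      using pq permutes_inj[OF \<sigma>] by (auto simp: fun_eq_iff s_def inj_def intro!: exI[of _ p])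
    ultimately show False
      using less[of "\<sigma> \<circ> s" f] max permutes_compose[OF s \<sigma>] by auto
  qed
  then have f: "f permutes UNIV"
    using bij_imp_permutes[of f UNIV] finite_UNIV_inj_surj[of f] by (auto simp: bij_def)
  obtain a b where ab: "(\<Prod>i\<in>UNIV. A $ i $ f i) = Tan a" "(\<Prod>i\<in>UNIV. B $ f i $ \<sigma> i) = Tan b"
    "t = a + b"
    using max by (auto simp: F_def mult_eq_Tan_iff)
  have "(\<Prod>i\<in>UNIV. A $ i $ g i) < Tan a" if g: "g permutes UNIV" "g \<noteq> f" for g
  proof -
    \<comment> \<open>\<open>\<sigma> \<circ> s\<close> is chosen such that the pair \<open>(\<sigma> \<circ> s, g)\<close> uses the same entries of \<open>B\<close> as \<open>(\<sigma>, f)\<close>.\<close>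
    define s where "s = inv f \<circ> g"
    have s: "s permutes UNIV"
      unfolding s_def using f g by (intro permutes_compose permutes_inv)
    have fs: "f (s i) = g i" for i
      using permutes_inverses(1)[OF f] by (simp add: s_def)
    have "F (\<sigma> \<circ> s) g = (\<Prod>i\<in>UNIV. A $ i $ g i) * Tan b"
      unfolding F_def
      using prod.permute[OF s, of "\<lambda>i. B $ f i $ \<sigma> i"] by (simp add: fs o_def ab(2))
    then show ?thesis
      using less[of "\<sigma> \<circ> s" g] permutes_compose[OF s \<sigma>] g ab(3)
      by (simp add: mult.commute[of _ "Tan b"] add.commute[of a])
  qed
  with f ab(1) show ?thesis
    unfolding trop_regular_iff by blast
qed

section \<open>Potentials\<close>

fun walk_weight :: "('n \<Rightarrow> 'n \<Rightarrow> xtrop) \<Rightarrow> 'n list \<Rightarrow> xtrop" where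
  "walk_weight a (x # y # ys) = a x y * walk_weight a (y # ys)"
| "walk_weight a _ = 1"

lemma walk_weight_append:
  "walk_weight a (xs @ y # ys) = walk_weight a (xs @ [y]) * walk_weight a (y # ys)"
  by (induction a xs rule: walk_weight.induct) (auto simp: mult.assoc)

lemma walk_weight_cong:
  "(\<And>x y. y \<in> set ys \<Longrightarrow> a x y = b x y) \<Longrightarrow> walk_weight a (x # ys) = walk_weight b (x # ys)"
  by (induction ys arbitrary: x) auto

lemma walk_weight_snoc: "xs \<noteq> [] \<Longrightarrow> walk_weight a (xs @ [y]) = walk_weight a xs * a (last xs) y"
  by (induction a xs rule: walk_weight.induct) (auto simp: mult.assoc)

text \<open>Since the cycle through \<open>x, y, \<dots>\<close> is the transposition of \<open>x\<close> and \<open>y\<close> composed with the cycle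
  through \<open>y, \<dots>\<close>, the induction hypothesis is applied to weights with the target vertices \<open>x\<close> and
  \<open>y\<close> exchanged; only the closing edge sees the exchange.\<close>

lemma prod_cycle_of_list:
  "distinct (x # xs) \<Longrightarrow>
    (\<Prod>i\<in>set (x # xs). a i (cycle_of_list (x # xs) i)) = walk_weight a (x # xs @ [x])"
proof (induction xs arbitrary: x a)
  case (Cons y xs)
  define b where "b = (\<lambda>i j. a i (Transposition.transpose x y j))"
  have "(\<Prod>i\<in>set (x # y # xs). a i (cycle_of_list (x # y # xs) i)) =
     a x y * (\<Prod>i\<in>set (y # xs). b i (cycle_of_list (y # xs) i))"
    using Cons.prems id_outside_supp[of x "y # xs"] by (simp add: b_def)
  also have "\<dots> = a x y * walk_weight b (y # xs @ [y])"
    using Cons by auto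
  also have "walk_weight b (y # xs @ [y]) = walk_weight b (y # xs) * b (last (y # xs)) y"
    using walk_weight_snoc[of "y # xs"] by simp
  also have "walk_weight b (y # xs) = walk_weight a (y # xs)"
    using Cons.prems by (intro walk_weight_cong) (auto simp: b_def Transposition.transpose_def)
  also have "b (last (y # xs)) y = a (last (y # xs)) x"
    by (simp add: b_def)
  also have "walk_weight a (y # xs) * a (last (y # xs)) x = walk_weight a ((y # xs) @ [x])"
    by (rule walk_weight_snoc [symmetric]) simp
  finally show ?case by simp
qed simp

text \<open>The cycle through \<open>x # xs\<close> extends by fixed points, of weight \<open>1\<close>, to a permutation of
  all indices.\<close>

lemma closed_walk_le:
  fixes a :: "'n::finite \<Rightarrow> 'n \<Rightarrow> xtrop"
  assumes perm: "\<And>\<pi>. \<pi> permutes UNIV \<Longrightarrow> (\<Prod>i\<in>UNIV. a i (\<pi> i)) \<le> c"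
    and diag: "\<And>i. a i i = 1" and dist: "distinct (x # xs)"
  shows "walk_weight a (x # xs @ [x]) \<le> c"
proof -
  define \<pi> where "\<pi> = cycle_of_list (x # xs)"
  have "\<pi> permutes UNIV"
    unfolding \<pi>_def by (rule permutes_subset[OF cycle_permutes]) simp
  moreover have "(\<Prod>i\<in>UNIV. a i (\<pi> i)) = (\<Prod>i\<in>set (x # xs). a i (\<pi> i))"
    unfolding \<pi>_def using diag id_outside_supp[of _ "x # xs"]
    by (intro prod.mono_neutral_right) (auto simp del: cycle_of_list.simps)
  ultimately show ?thesis
    using perm[of \<pi>] prod_cycle_of_list[OF dist, of a] by (simp add: \<pi>_def)
qed

text \<open>Dual solution of the assignment problem: \<open>u i\<close> is the maximal weight of a walk without
  repeated vertices that starts at \<open>i\<close>. Prefixing the best walk from \<open>j\<close> by the edge from \<open>i\<close> to \<open>j\<close>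
  either gives such a walk from \<open>i\<close>, or it runs into \<open>i\<close> again; then the initial closed part has
  weight at most \<open>1\<close> and can be cut off.\<close>

lemma ex_potential:
  fixes a :: "'n::finite \<Rightarrow> 'n \<Rightarrow> xtrop"
  assumes perm: "\<And>\<pi>. \<pi> permutes UNIV \<Longrightarrow> (\<Prod>i\<in>UNIV. a i (\<pi> i)) \<le> 1"
    and diag: "\<And>i. a i i = 1"
  shows "\<exists>u. \<forall>i j. a i j \<le> Gho (u i - u j)"
proof -
  define P where "P = (\<lambda>i::'n. {xs. distinct (i # xs)})"
  define m where "m = (\<lambda>i. Max ((\<lambda>xs. walk_weight a (i # xs)) ` P i))"
  have fin: "finite (P i)" for i
    by (rule finite_subset[OF _ finite_subset_distinct[of UNIV]]) (auto simp: P_def)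
  have ne: "P i \<noteq> {}" for i
    by (auto simp: P_def intro: exI[of _ "[]"])
  have le_m: "walk_weight a (i # xs) \<le> m i" if "distinct (i # xs)" for i xs
    unfolding m_def using that fin by (intro Max_ge) (auto simp: P_def)
  have m_attained: "\<exists>xs. distinct (i # xs) \<and> m i = walk_weight a (i # xs)" for i
  proof -
    have "m i \<in> (\<lambda>xs. walk_weight a (i # xs)) ` P i"
      unfolding m_def using fin ne by (intro Max_in) auto
    then show ?thesis by (auto simp: P_def)
  qed
  \<comment> \<open>The walk consisting of \<open>i\<close> alone shows \<open>1 \<le> m i\<close>, so \<open>m i\<close> is not \<open>NegInf\<close>.\<close>
  have "\<exists>r. Tan r \<le> m i \<and> m i \<le> Gho r" for i
    using le_m[of i "[]"] by (cases "m i") (auto simp: one_xtrop_def)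
  then obtain u where u: "\<And>i. Tan (u i) \<le> m i" "\<And>i. m i \<le> Gho (u i)"
    by metis
  have "a i j * m j \<le> m i" for i j
  proof -
    obtain xs where xs: "distinct (j # xs)" "m j = walk_weight a (j # xs)"
      using m_attained by blast
    show ?thesis
    proof (cases "i \<in> set (j # xs)")
      case False
      then show ?thesis using le_m[of i "j # xs"] xs by simp
    next
      case True
      then obtain ps qs where split: "j # xs = ps @ i # qs"
        by (meson split_list)
      have "a i j * m j = walk_weight a (i # ps @ i # qs)"
        unfolding xs(2) split[symmetric] by simp
      also have "\<dots> = walk_weight a (i # ps @ [i]) * walk_weight a (i # qs)"
        using walk_weight_append[of a "i # ps" i qs] by simp
      also have "\<dots> \<le> 1 * m i"
        using xs(1) split by (intro xtrop_mult_mono closed_walk_le perm diag le_m) auto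
      finally show ?thesis by simp
    qed
  qed
  then have "a i j * Tan (u j) \<le> Gho (u i)" for i j
    by (meson order.trans order.refl u xtrop_mult_mono)
  note edge = this
  have "a i j \<le> Gho (u i - u j)" for i j
    using edge[of i j]
    by (cases "a i j") (simp_all add: le_diff_eq)
  then show ?thesis by blast
qed

lemma finite_less_one_margin:
  assumes "finite X" "\<And>x. x \<in> X \<Longrightarrow> x < (1 :: xtrop)"
  shows "\<exists>\<epsilon>>0. \<forall>x\<in>X. x * Tan \<epsilon> \<le> 1"
  using assms
proof (induction X rule: finite_induct)
  case empty
  show ?case by (auto intro: exI[of _ 1])
next
  case (insert x X)
  then obtain \<epsilon> where \<epsilon>: "\<epsilon> > 0" "\<forall>x\<in>X. x * Tan \<epsilon> \<le> 1" by auto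
  obtain \<delta> where \<delta>: "\<delta> > 0" "x * Tan \<delta> \<le> 1"
  proof (cases x)
    case NegInf
    then show ?thesis using that[of 1] by (simp add: one_xtrop_def)
  next
    case (Tan r)
    then show ?thesis using that[of "- r"] insert.prems[of x] by (simp add: one_xtrop_def)
  next
    case (Gho r)
    then show ?thesis using that[of "- r / 2"] insert.prems[of x] by (simp add: one_xtrop_def)
  qed
  have mono: "y * Tan (min \<epsilon> \<delta>) \<le> y * Tan \<epsilon>" "y * Tan (min \<epsilon> \<delta>) \<le> y * Tan \<delta>" for y
    by (auto intro!: xtrop_mult_mono)
  with \<epsilon> \<delta> show ?case
    by (intro exI[of _ "min \<epsilon> \<delta>"]) (auto intro: order.trans)
qed

text \<open>As there are only finitely many permutations, their weights stay at most \<open>1\<close> when every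
  off-diagonal entry is raised by a small \<open>\<delta>\<close>. Weak potentials for the raised entries are
  strict for the original ones.\<close>

lemma ex_strict_potential:
  fixes a :: "'n::finite \<Rightarrow> 'n \<Rightarrow> xtrop"
  assumes perm: "\<And>\<pi>. \<pi> permutes UNIV \<Longrightarrow> \<pi> \<noteq> id \<Longrightarrow> (\<Prod>i\<in>UNIV. a i (\<pi> i)) < 1"
    and diag: "\<And>i. a i i = 1"
  shows "\<exists>u \<epsilon>. \<epsilon> > 0 \<and> (\<forall>i j. i \<noteq> j \<longrightarrow> a i j \<le> Gho (u i - u j - \<epsilon>))"
proof -
  obtain \<epsilon> where \<epsilon>: "\<epsilon> > 0"
    "\<And>\<pi>. \<pi> permutes UNIV \<Longrightarrow> \<pi> \<noteq> id \<Longrightarrow> (\<Prod>i\<in>UNIV. a i (\<pi> i)) * Tan \<epsilon> \<le> 1"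
    using finite_less_one_margin[of
        "(\<lambda>\<pi>. \<Prod>i\<in>UNIV. a i (\<pi> i)) ` ({\<pi>. \<pi> permutes UNIV} - {id})"] perm
    by (auto simp: finite_permutations)
  \<comment> \<open>A permutation uses at most \<open>CARD('n)\<close> off-diagonal entries.\<close>
  define \<delta> where "\<delta> = \<epsilon> / real (CARD('n))"
  have \<delta>: "\<delta> > 0" "real (CARD('n)) * \<delta> = \<epsilon>"
    using \<epsilon>(1) by (auto simp: \<delta>_def)
  define b where "b = (\<lambda>i j. if i = j then a i i else a i j * Tan \<delta>)"
  have "(\<Prod>i\<in>UNIV. b i (\<pi> i)) \<le> 1" if \<pi>: "\<pi> permutes UNIV" for \<pi>
  proof (cases "\<pi> = id")
    case False
    have "b i j \<le> a i j * Tan \<delta>" for i j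
      using \<delta>(1) by (auto simp: b_def diag one_xtrop_def)
    then have "(\<Prod>i\<in>UNIV. b i (\<pi> i)) \<le> (\<Prod>i\<in>UNIV. a i (\<pi> i) * Tan \<delta>)"
      by (intro xtrop_prod_mono)
    also have "\<dots> = (\<Prod>i\<in>UNIV. a i (\<pi> i)) * Tan \<epsilon>"
      using prod_Tan[of "\<lambda>_. \<delta>" "UNIV :: 'n set"] \<delta>(2) by (simp add: prod.distrib)
    also have "\<dots> \<le> 1"
      using \<epsilon>(2) \<pi> False by blast
    finally show ?thesis .
  qed (simp add: b_def diag)
  moreover have "b i i = 1" for i
    by (simp add: b_def diag)
  ultimately obtain u where u: "\<And>i j. b i j \<le> Gho (u i - u j)"
    using ex_potential[of b] by blast
  have "a i j \<le> Gho (u i - u j - \<delta>)" if "i \<noteq> j" for i j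
    using u[of i j] that by (cases "a i j") (auto simp: b_def)
  with \<delta>(1) show ?thesis by blast
qed

section \<open>Idempotent pseudo units from potentials\<close>

definition potential_unit :: "('n \<Rightarrow> real) \<Rightarrow> real \<Rightarrow> xtrop ^ 'n ^ 'n" where
  "potential_unit u \<epsilon> = (\<chi> i j. if i = j then 1 else Gho (u i - u j - \<epsilon>))"

text \<open>With \<open>U = potential_unit u \<epsilon>\<close>, the detour \<open>i, k, j\<close> collects the slack \<open>\<epsilon>\<close> twice, so
  \<open>U i k * U k j \<le> U i j\<close>, and a return to \<open>i\<close> has weight \<open>(- 2 * \<epsilon>)\<^sup>\<nu>\<close>, below the unit.
  So the diagonal of \<open>M ** N\<close> stays at \<open>1\<close>, and off the diagonal the term in which the factor \<open>U\<close>
  meets a diagonal entry of the other one is the dominating ghost.\<close>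

lemma matrix_mult_potential_unit:
  fixes M N :: "xtrop ^ 'n ^ 'n"
  assumes \<epsilon>: "\<epsilon> > 0"
    and diag: "\<And>i. M $ i $ i = 1" "\<And>i. N $ i $ i = 1"
    and le: "\<And>i j. M $ i $ j \<le> potential_unit u \<epsilon> $ i $ j"
            "\<And>i j. N $ i $ j \<le> potential_unit u \<epsilon> $ i $ j"
    and eq: "M = potential_unit u \<epsilon> \<or> N = potential_unit u \<epsilon>"
  shows "M ** N = potential_unit u \<epsilon>"
proof -
  define U where "U = potential_unit u \<epsilon>"
  have term_le: "M $ i $ k * N $ k $ j \<le> U $ i $ k * U $ k $ j" for i j k
    using le by (auto simp: U_def intro: xtrop_mult_mono)
  have "(\<Sum>k\<in>UNIV. M $ i $ k * N $ k $ j) = U $ i $ j" for i j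
  proof (cases "i = j")
    case True
    have "M $ i $ k * N $ k $ i < Tan 0" if "k \<noteq> i" for k
    proof -
      have "U $ i $ k * U $ k $ i < Tan 0"
        using that \<epsilon> by (simp add: U_def potential_unit_def)
      then show ?thesis
        using term_le[of i k i] by order
    qed
    then have "(\<Sum>k\<in>UNIV. M $ i $ k * N $ k $ i) = Tan 0"
      by (subst sum_eq_Tan_iff) (auto simp: diag one_xtrop_def intro!: exI[of _ i])
    with True show ?thesis
      by (simp add: U_def potential_unit_def one_xtrop_def)
  next
    case False
    have "U $ i $ k * U $ k $ j \<le> U $ i $ j" for k
      using False \<epsilon> by (auto simp: U_def potential_unit_def)
    then have *: "M $ i $ k * N $ k $ j \<le> U $ i $ j" for k
      using term_le order.trans by blast
    obtain k where k: "M $ i $ k * N $ k $ j = U $ i $ j"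
      using eq diag by (metis U_def mult.left_neutral mult.right_neutral)
    have "U $ i $ j \<in> ghosts_bar"
      using False by (simp add: U_def potential_unit_def ghosts_bar_def)
    with k * show ?thesis
      using sum_eq_ghost[of UNIV k "\<lambda>k. M $ i $ k * N $ k $ j"] by simp
  qed
  then show ?thesis
    by (simp add: matrix_matrix_mult_def U_def vec_eq_iff)
qed

text \<open>Potential differences cancel along a permutation, which leaves one factor \<open>(- \<epsilon>)\<^sup>\<nu>\<close> for
  every index that is moved.\<close>

lemma trop_regular_potential_unit:
  assumes "\<epsilon> > 0" shows "trop_regular (potential_unit u \<epsilon> :: xtrop ^ 'n ^ 'n)"
proof -
  define p :: "'n \<Rightarrow> 'n \<Rightarrow> xtrop" where "p = (\<lambda>i j. if i = j then 1 else Gho (- \<epsilon>))"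
  have p_less: "p i j < 1" if "i \<noteq> j" for i j
    using assms that by (simp add: p_def one_xtrop_def)
  have p_le: "p i j \<le> 1" for i j
    using p_less[of i j] by (cases "i = j") (auto simp: p_def)
  have "potential_unit u \<epsilon> $ i $ j = p i j * Tan (u i - u j)" for i j
    by (simp add: potential_unit_def p_def one_xtrop_def)
  then have *: "(\<Prod>i\<in>UNIV. potential_unit u \<epsilon> $ i $ \<pi> i) = (\<Prod>i\<in>UNIV. p i (\<pi> i))"
    if "\<pi> permutes UNIV" for \<pi>
    using sum.permute[OF that, of u]
    by (simp add: prod.distrib prod_Tan sum_subtractf one_xtrop_eq o_def)
  have "(\<Prod>i\<in>UNIV. p i (\<pi> i)) < Tan 0" if "\<pi> \<noteq> id" for \<pi>
  proof -
    from \<open>\<pi> \<noteq> id\<close> obtain j where "\<pi> j \<noteq> j" by (auto simp: fun_eq_iff)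
    then show ?thesis
      using prod_less_one[of UNIV j "\<lambda>i. p i (\<pi> i)"] p_less[of j "\<pi> j"] p_le
      by (simp add: one_xtrop_eq)
  qed
  then have "(\<Prod>i\<in>UNIV. potential_unit u \<epsilon> $ i $ \<pi> i) < Tan 0"
    if "\<pi> permutes UNIV" "\<pi> \<noteq> id" for \<pi>
    using that by (simp add: *)
  moreover have "(\<Prod>i\<in>UNIV. potential_unit u \<epsilon> $ i $ id i) = Tan 0"
    by (simp add: potential_unit_def one_xtrop_eq)
  ultimately show ?thesis
    unfolding trop_regular_iff using permutes_id by blast
qed

lemma potential_unit_in_U_idm:
  assumes "\<epsilon> > 0" shows "potential_unit u \<epsilon> \<in> U_idm"
  using assms trop_regular_potential_unit[OF assms, of u]
  by (auto simp: U_idm_def pseudo_unit_def intro!: matrix_mult_potential_unit)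
    (auto simp: potential_unit_def one_xtrop_def ghosts_bar_def)

section \<open>Density of regular matrices\<close>

lemma trop_regular_imp_E_dense:
  fixes A :: "xtrop ^ 'n ^ 'n"
  assumes "trop_regular A" shows "E_dense_wrt U_idm A"
proof -
  obtain \<sigma> t where \<sigma>: "\<sigma> permutes UNIV" and max: "(\<Prod>i\<in>UNIV. A $ i $ \<sigma> i) = Tan t"
    and less: "\<And>\<tau>. \<tau> permutes UNIV \<Longrightarrow> \<tau> \<noteq> \<sigma> \<Longrightarrow> (\<Prod>i\<in>UNIV. A $ i $ \<tau> i) < Tan t"
    using assms unfolding trop_regular_iff by blast
  obtain d where d: "\<And>i. A $ i $ \<sigma> i = Tan (d i)"
    using prod_eq_TanD[OF max] by (metis UNIV_I finite)
  have t: "t = (\<Sum>i\<in>UNIV. d i)"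
    using max by (simp add: d prod_Tan)
  \<comment> \<open>The row of \<open>A\<close> whose optimal entry lies in column \<open>k\<close> becomes row \<open>k\<close>, scaled to have \<open>1\<close> there.\<close>
  define N where "N = (\<chi> k l. A $ inv \<sigma> k $ l * Tan (- d (inv \<sigma> k)))"
  have N: "N $ \<sigma> i $ l = A $ i $ l * Tan (- d i)" for i l
    using permutes_inverses(2)[OF \<sigma>] by (simp add: N_def)
  have A: "A $ i $ l = Tan (d i) * N $ \<sigma> i $ l" for i l
    by (cases "A $ i $ l") (simp_all add: N)
  have N_diag: "N $ k $ k = 1" for k
    using permutes_inverses(1)[OF \<sigma>] d[of "inv \<sigma> k"] by (simp add: N_def one_xtrop_def)
  have "(\<Prod>k\<in>UNIV. N $ k $ \<pi> k) < 1" if \<pi>: "\<pi> permutes UNIV" "\<pi> \<noteq> id" for \<pi>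
  proof -
    have "(\<Prod>k\<in>UNIV. N $ k $ \<pi> k) = (\<Prod>i\<in>UNIV. N $ \<sigma> i $ \<pi> (\<sigma> i))"
      using prod.permute[OF \<sigma>, of "\<lambda>k. N $ k $ \<pi> k"] by (simp add: o_def)
    also have "\<dots> = Tan (- t) * (\<Prod>i\<in>UNIV. A $ i $ (\<pi> \<circ> \<sigma>) i)"
      by (simp add: N prod.distrib prod_Tan sum_negf t mult.commute)
    also have "\<dots> < Tan (- t + t)"
    proof -
      have "\<pi> \<circ> \<sigma> \<noteq> \<sigma>"
        using \<pi>(2) permutes_inverses(1)[OF \<sigma>] by (metis comp_apply eq_id_iff)
      then show ?thesis
        unfolding Tan_mult_cancel_less using less permutes_compose[OF \<sigma> \<pi>(1)] by blast
    qed
    finally show ?thesis by (simp add: one_xtrop_def)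
  qed
  then obtain u \<epsilon> where \<epsilon>: "\<epsilon> > 0" and u: "\<And>i j. i \<noteq> j \<Longrightarrow> N $ i $ j \<le> Gho (u i - u j - \<epsilon>)"
    using ex_strict_potential[of "\<lambda>i j. N $ i $ j"] N_diag by blast
  define U :: "xtrop ^ 'n ^ 'n" where "U = potential_unit u \<epsilon>"
  have U_diag: "U $ i $ i = 1" for i
    by (simp add: U_def potential_unit_def)
  have N_le: "N $ i $ j \<le> U $ i $ j" for i j
    using u[of i j] N_diag by (auto simp: U_def potential_unit_def)
  have NU: "N ** U = U" and UN: "U ** N = U"
    using matrix_mult_potential_unit[OF \<epsilon>, of N U u] matrix_mult_potential_unit[OF \<epsilon>, of U N u]
      N_diag U_diag N_le by (auto simp: U_def)
  \<comment> \<open>As \<open>U\<close> absorbs \<open>N\<close> on both sides, it remains to undo the permutation and the scaling.\<close>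
  define B :: "xtrop ^ 'n ^ 'n" where "B = (\<chi> k j. U $ k $ \<sigma> j * Tan (- d j))"
  have "(A ** B) $ i $ j = potential_unit (\<lambda>i. d i + u (\<sigma> i)) \<epsilon> $ i $ j" for i j
  proof -
    have "(A ** B) $ i $ j = Tan (d i) * (N ** U) $ \<sigma> i $ \<sigma> j * Tan (- d j)"
      by (simp add: matrix_matrix_mult_def A B_def sum_distrib_left sum_distrib_right mult_ac)
    then show ?thesis
      using permutes_inj[OF \<sigma>] unfolding NU
      by (auto simp: U_def potential_unit_def one_xtrop_def inj_def)
  qed
  then have "A ** B = potential_unit (\<lambda>i. d i + u (\<sigma> i)) \<epsilon>"
    by (simp add: vec_eq_iff)
  moreover have "B ** A = U"
  proof -
    have "(B ** A) $ k $ l = U $ k $ l" for k l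
    proof -
      have "(B ** A) $ k $ l = (\<Sum>j\<in>UNIV. U $ k $ \<sigma> j * N $ \<sigma> j $ l)"
        by (simp add: matrix_matrix_mult_def B_def N mult_ac)
      also have "\<dots> = (U ** N) $ k $ l"
        using sum.permute[OF \<sigma>, of "\<lambda>m. U $ k $ m * N $ m $ l"]
        by (simp add: matrix_matrix_mult_def o_def)
      finally show ?thesis by (simp add: UN)
    qed
    then show ?thesis by (simp add: vec_eq_iff)
  qed
  ultimately show ?thesis
    unfolding E_dense_wrt_def U_def using potential_unit_in_U_idm[OF \<epsilon>] by metis
qed

theorem corollary3p9:
  fixes A :: "xtrop ^ 'n ^ 'n"
  shows "E_dense_wrt U_idm A \<longleftrightarrow> trop_regular A"
proof
  assume "E_dense_wrt U_idm A"
  then obtain B where "A ** B \<in> U_idm"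
    by (auto simp: E_dense_wrt_def)
  then have "trop_regular (A ** B)"
    by (simp add: U_idm_def pseudo_unit_def)
  then show "trop_regular A"
    by (rule trop_regular_mult_left)
qed (rule trop_regular_imp_E_dense)

end
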